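(* Let $L>0$, $E>0$, $A>0$ be constants, let $P\in C([0,L])$, and let $J:U\to\mathbb{R}$ be defined by $$J(u)=\frac{EA}{2}\int_0^L\left(u_x+\frac12 u_x^2\right)^2dx-\int_0^L Pu\,dx .$$ Assume $u_0\in\hat U$ (that is, $u_0\in U$ and $\|(u_0)_x\|_\infty<1/4$) is such that $\delta J(u_0)=\mathbf{0}$. Let $K=EA/2$ and define $$\hat z^*=K(u_0)_x,\qquad \hat v_2^*=EA\left((u_0)_x+\frac12 (u_0)_x^2\right)-\hat z^*,\qquad \hat v_1^*=(\hat z^*+\hat v_2^*+K)(u_0)_x,$$ and $\hat v^*=(\hat v_1^*,\hat v_2^* )$. Let $J^*(v^*,z^* )=F^*(z^* )-G_K^*(v^*,z^* )$ and $A^*$ be the dual functional and the constraint set defined in the context. Then $$\delta^2J(u_0,\varphi,\varphi)\ge 0\quad\text{for all }\varphi\in C_c^1((0,L)),$$ and there exist $r,r_1,r_2>0$ such that $$J(u_0)=\inf_{u\in B_r(u_0)}J(u)=\sup_{v^*\in B_{r_2}(\hat v^* )\cap A^*}\left\{\inf_{z^*\in B_{r_1}(\hat z^* )}J^*(v^*,z^* )\right\}=J^*(\hat v^*,\hat z^* ).$$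
   Context: Throughout, $\Omega=[0,L]\subset\mathbb{R}$, the subscript $x$ denotes the derivative $d/dx$, and $\langle f,g\rangle_{L^2}=\int_0^L fg\,dx$. Spaces: $U=\{u\in C^1([0,L]) : u(0)=u(L)=0\}$ with norm $\|u\|_U=\max_{x\in[0,L]}\{|u(x)|+|u_x(x)|\}$; $\hat U=\{u\in U:\|u_x\|_\infty<1/4\}$; $V=C([0,L])$ with norm $\|v\|_V=\|v\|_\infty=\max_{x\in[0,L]}|v(x)|$; $V\times V$ carries the standard product norm (e.g. the maximum of the two component norms). Balls: for $u\in U$, $B_r(u)=\{w\in U:\|w-u\|_U<r\}$; for $z^*\in V$, $B_{r_1}(z^* )=\{v\in V:\|v-z^*\|_V<r_1\}$; for $v^*\in V\times V$, $B_{r_2}(v^* )$ is the open ball of radius $r_2$ about $v^*$ in $V\times V$. Variations: $\delta J(u_0)=\mathbf{0}$ means that the first (Gateaux) variation of $J$ at $u_0$ vanishes in every direction $\varphi\in U$; $\delta^2J(u_0,\varphi,\varphi)=\frac{d^2}{d\varepsilon^2}J(u_0+\varepsilon\varphi)\big|_{\varepsilon=0}$. $C^1_c((0,L))$ is the space of $C^1$ functions with compact support in $(0,L)$. Dual functionals: with $K=EA/2$ and $F(v)=\frac K2\int_0^L v^2\,dx$ for $v\in V$, set for $z^*\in V$ $$F^*(z^* )=\sup_{v\in V}\{\langle v,z^*\rangle_{L^2}-F(v)\}=\frac{1}{2K}\int_0^L (z^* )^2\,dx .$$ For $v^*=(v_1^*,v_2^* )\in V\times V$ and $z^*\in V$ set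 $$G_K^*(v^*,z^* )=\sup_{(v_1,v_2)\in V\times V}\left\{\langle v_1,z^*+v_2^*\rangle_{L^2}+\langle v_2,v_1^*\rangle_{L^2}-\frac{EA}{2}\int_0^L\left(v_1+\frac12v_2^2\right)^2dx-\frac K2\int_0^L v_2^2\,dx\right\},$$ which, if $v_2^*+z^*+K>0$ in $\Omega$, equals $$\frac12\int_0^L\frac{(v_1^* )^2}{z^*+v_2^*+K}\,dx+\frac{1}{2EA}\int_0^L(v_2^*+z^* )^2\,dx .$$ $J^*$ is the functional on $V\times V\times V$ given by $J^*(v^*,z^* )=F^*(z^* )-G_K^*(v^*,z^* )$, with values in $[-\infty,\infty)$ (it is finite whenever $v_2^*+z^*+K>0$ in $\Omega$). Constraint set: $A^*=\{v^*=(v_1^*,v_2^* )\in V\times V : (v_1^* )_x+(v_2^* )_x+P=0\text{ in }\Omega\}$. *)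

theory Defs
  imports "HOL-Analysis.Analysis" "HOL-Library.Extended_Real"
begin

text \<open>
  A function on \<open>[0,L]\<close> is represented by a function on \<open>real\<close> of which only the values on
  \<open>{0..L}\<close> matter: every notion below depends only on the restriction to \<open>{0..L}\<close>, and
  derivatives are taken within \<open>{0..L}\<close>, hence one-sided at the end points.
\<close>

definition Dx :: "real \<Rightarrow> (real \<Rightarrow> real) \<Rightarrow> real \<Rightarrow> real" where
  "Dx L u x = vector_derivative u (at x within {0..L})"

definition L2_inner :: "real \<Rightarrow> (real \<Rightarrow> real) \<Rightarrow> (real \<Rightarrow> real) \<Rightarrow> real" where
  "L2_inner L f g = integral {0..L} (\<lambda>x. f x * g x)"

definition V_space :: "real \<Rightarrow> (real \<Rightarrow> real) set" where
  "V_space L = {v. continuous_on {0..L} v}"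

definition V_norm :: "real \<Rightarrow> (real \<Rightarrow> real) \<Rightarrow> real" where
  "V_norm L v = (SUP x\<in>{0..L}. \<bar>v x\<bar>)"

definition U_space :: "real \<Rightarrow> (real \<Rightarrow> real) set" where
  "U_space L = {u. u differentiable_on {0..L} \<and> continuous_on {0..L} (Dx L u) \<and> u 0 = 0 \<and> u L = 0}"

definition U_norm :: "real \<Rightarrow> (real \<Rightarrow> real) \<Rightarrow> real" where
  "U_norm L u = (SUP x\<in>{0..L}. \<bar>u x\<bar> + \<bar>Dx L u x\<bar>)"

definition U_hat :: "real \<Rightarrow> (real \<Rightarrow> real) set" where
  "U_hat L = {u \<in> U_space L. V_norm L (Dx L u) < 1/4}"

definition U_ball :: "real \<Rightarrow> (real \<Rightarrow> real) \<Rightarrow> real \<Rightarrow> (real \<Rightarrow> real) set" where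
  "U_ball L u r = {w \<in> U_space L. U_norm L (\<lambda>x. w x - u x) < r}"

definition V_ball :: "real \<Rightarrow> (real \<Rightarrow> real) \<Rightarrow> real \<Rightarrow> (real \<Rightarrow> real) set" where
  "V_ball L z r = {v \<in> V_space L. V_norm L (\<lambda>x. v x - z x) < r}"

definition VV_ball ::
  "real \<Rightarrow> (real \<Rightarrow> real) \<times> (real \<Rightarrow> real) \<Rightarrow> real \<Rightarrow> ((real \<Rightarrow> real) \<times> (real \<Rightarrow> real)) set" where
  "VV_ball L w r = {v \<in> V_space L \<times> V_space L.
     max (V_norm L (\<lambda>x. fst v x - fst w x)) (V_norm L (\<lambda>x. snd v x - snd w x)) < r}"

text \<open>
  Elements of \<open>C1_c((0,L))\<close> are regarded as functions on \<open>[0,L]\<close> through extension by zero,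
  so that the support below also sees the end points.
\<close>

definition C1c_space :: "real \<Rightarrow> (real \<Rightarrow> real) set" where
  "C1c_space L = {\<phi>. \<phi> C1_differentiable_on {0<..<L} \<and>
     compact (closure {x \<in> {0..L}. \<phi> x \<noteq> 0}) \<and> closure {x \<in> {0..L}. \<phi> x \<noteq> 0} \<subseteq> {0<..<L}}"

definition J_primal ::
  "real \<Rightarrow> real \<Rightarrow> real \<Rightarrow> (real \<Rightarrow> real) \<Rightarrow> (real \<Rightarrow> real) \<Rightarrow> real" where
  "J_primal L E A P u =
     E * A / 2 * integral {0..L} (\<lambda>x. (Dx L u x + 1/2 * (Dx L u x)\<^sup>2)\<^sup>2)
     - integral {0..L} (\<lambda>x. P x * u x)"

definition first_variation_zero ::
  "((real \<Rightarrow> real) \<Rightarrow> real) \<Rightarrow> (real \<Rightarrow> real) set \<Rightarrow> (real \<Rightarrow> real) \<Rightarrow> bool" where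
  "first_variation_zero J X u \<longleftrightarrow>
     (\<forall>\<phi>\<in>X. ((\<lambda>\<epsilon>. J (\<lambda>x. u x + \<epsilon> * \<phi> x)) has_real_derivative 0) (at 0))"

definition second_variation ::
  "((real \<Rightarrow> real) \<Rightarrow> real) \<Rightarrow> (real \<Rightarrow> real) \<Rightarrow> (real \<Rightarrow> real) \<Rightarrow> real" where
  "second_variation J u \<phi> = deriv (deriv (\<lambda>\<epsilon>. J (\<lambda>x. u x + \<epsilon> * \<phi> x))) 0"

definition F_fun :: "real \<Rightarrow> real \<Rightarrow> (real \<Rightarrow> real) \<Rightarrow> real" where
  "F_fun L K v = K / 2 * integral {0..L} (\<lambda>x. (v x)\<^sup>2)"

definition F_star :: "real \<Rightarrow> real \<Rightarrow> (real \<Rightarrow> real) \<Rightarrow> ereal" where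
  "F_star L K z = (SUP v\<in>V_space L. ereal (L2_inner L v z - F_fun L K v))"

definition G_star ::
  "real \<Rightarrow> real \<Rightarrow> real \<Rightarrow> real \<Rightarrow> (real \<Rightarrow> real) \<times> (real \<Rightarrow> real) \<Rightarrow> (real \<Rightarrow> real) \<Rightarrow> ereal" where
  "G_star L E A K vs z = (SUP (v1, v2)\<in>V_space L \<times> V_space L. ereal (
       L2_inner L v1 (\<lambda>x. z x + snd vs x) + L2_inner L v2 (fst vs)
       - E * A / 2 * integral {0..L} (\<lambda>x. (v1 x + 1/2 * (v2 x)\<^sup>2)\<^sup>2)
       - K / 2 * integral {0..L} (\<lambda>x. (v2 x)\<^sup>2)))"

text \<open>
  For \<open>z\<close> in \<open>V_space L\<close> and \<open>K > 0\<close> the first term is finite, so the difference is a genuine one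
  and takes values in \<open>[-\<infinity>, \<infinity>)\<close>.
\<close>

definition J_star ::
  "real \<Rightarrow> real \<Rightarrow> real \<Rightarrow> real \<Rightarrow> (real \<Rightarrow> real) \<times> (real \<Rightarrow> real) \<Rightarrow> (real \<Rightarrow> real) \<Rightarrow> ereal" where
  "J_star L E A K vs z = F_star L K z - G_star L E A K vs z"

definition A_star :: "real \<Rightarrow> (real \<Rightarrow> real) \<Rightarrow> ((real \<Rightarrow> real) \<times> (real \<Rightarrow> real)) set" where
  "A_star L P = {(v1, v2). v1 \<in> V_space L \<and> v2 \<in> V_space L \<and>
     v1 differentiable_on {0..L} \<and> v2 differentiable_on {0..L} \<and>
     (\<forall>x\<in>{0..L}. Dx L v1 x + Dx L v2 x + P x = 0)}"

end

theory Submission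
  imports Defs
begin

text \<open>
  Write \<open>p\<close> for the derivative of the critical point \<open>u0\<close>, and \<open>K = E * A / 2\<close>. Everything about the
  nonlinearity is pointwise in \<open>p\<close>, and the size restriction on \<open>p\<close> enters through three polynomial
  or rational inequalities; the rest is integration and the Euler--Lagrange equation.

  \<^emph>\<open>Primal side.\<close> Along a line the energy is a quartic polynomial in the parameter
  (\<open>J_primal_expansion\<close>). Its linear coefficient gives the Euler--Lagrange equation in weak form, and
  its quadratic coefficient has a nonnegative density when \<open>p\<close> is at most 1/4 in absolute value,
  so the second variation is nonnegative. On that range, and for slopes within 1/4 of \<open>p\<close>, the energy
  density lies above its tangent at \<open>p\<close> (\<open>strain_sq_above_tangent\<close>). Integrating this and
  cancelling the linear terms by the weak equation shows that \<open>u0\<close> minimizes on the ball of radius 1/4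
  (\<open>J_primal_local_minimum\<close>).

  \<^emph>\<open>Weak duality.\<close> In the supremum that defines \<open>G_star\<close> insert the pair \<open>(p, p)\<close>. At \<open>z = K * p\<close>,
  where \<open>F_star\<close> is attained at \<open>p\<close>, the terms in \<open>z\<close> cancel, the constraint turns
  the terms in \<open>v*\<close> into the load, and what remains is \<open>J(u0)\<close>. Hence the inner infimum is at
  most \<open>J(u0)\<close> for every admissible \<open>v*\<close>, near or far (\<open>J_star_le_J_primal\<close>).

  \<^emph>\<open>Attainment.\<close> At the candidate \<open>v*\<close> the functional in \<open>z\<close> is stationary at \<open>K * p\<close>, with value
  \<open>J(u0)\<close>, and it stays above this value on the ball of radius \<open>K / 4\<close>
  (\<open>dual_integrand_lower\<close>, \<open>J_star_ge_J_primal\<close>). The candidate satisfies the constraint because its two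
  components add up to the axial force, whose derivative is \<open>- P\<close> by \<open>du_Bois_Reymond\<close>. The constraint
  also asks each component to be differentiable. This is a regularity statement on \<open>p\<close>,
  which holds because the force is a strictly monotone smooth function of \<open>p\<close>
  (\<open>differentiable_of_stress\<close>). The two bounds on \<open>J_star\<close> pinch the supremum, and also the value
  at the candidate pair, to \<open>J(u0)\<close>.
\<close>

section \<open>Pointwise algebra\<close>

definition strain :: "real \<Rightarrow> real" where
  "strain p = p + 1/2 * p\<^sup>2"

text \<open>
  Half the derivative of the squared strain: \<open>E * A * stress p\<close> is the derivative of the energy density,
  i.e. the axial force.
\<close>

definition stress :: "real \<Rightarrow> real" where
  "stress p = strain p * (1 + p)"

lemma continuous_on_strain [continuous_intros]:
  "continuous_on S f \<Longrightarrow> continuous_on S (\<lambda>x. strain (f x))"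
  unfolding strain_def by (intro continuous_intros)

lemma continuous_on_stress [continuous_intros]:
  "continuous_on S f \<Longrightarrow> continuous_on S (\<lambda>x. stress (f x))"
  unfolding stress_def by (intro continuous_intros)

lemma strain_sq_expansion:
  "(strain (p + e * q))\<^sup>2 = (strain p)\<^sup>2 + e * (2 * (stress p * q))
     + e^2 * ((strain p + (1 + p)\<^sup>2) * q\<^sup>2) + e^3 * ((1 + p) * q^3) + e^4 * (q^4 / 4)"
  unfolding strain_def stress_def
  by (simp add: power2_eq_square power3_eq_cube power4_eq_xxxx field_simps)

lemma strain_lower: "\<bar>p\<bar> \<le> 1/4 \<Longrightarrow> strain p \<ge> - 1/4"
  unfolding strain_def using zero_le_power2[of p] by linarith

lemma stiffness_nonneg:
  assumes "\<bar>p\<bar> \<le> 1/4" shows "strain p + (1 + p)\<^sup>2 \<ge> 0"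
proof -
  have "(3/4)\<^sup>2 \<le> (1 + p)\<^sup>2" using assms by (intro power_mono) auto
  then show ?thesis using strain_lower[OF assms] by (simp add: power2_eq_square)
qed

text \<open>
  After division by \<open>h\<^sup>2\<close> the remainder of the quartic is the sum of the strain, bounded below by -1/4,
  and the square of \<open>1 + p + h/2\<close>, which is at least 5/8.
\<close>

lemma strain_sq_above_tangent:
  assumes "\<bar>p\<bar> \<le> 1/4" and "\<bar>h\<bar> \<le> 1/4"
  shows "(strain p)\<^sup>2 + 2 * (stress p * h) \<le> (strain (p + h))\<^sup>2"
proof -
  have "(5/8)\<^sup>2 \<le> (1 + p + h/2)\<^sup>2" using assms by (intro power_mono) auto
  then have "0 \<le> h\<^sup>2 * (strain p + (1 + p + h/2)\<^sup>2)"
    using strain_lower[OF assms(1)] by (intro mult_nonneg_nonneg) (auto simp: power2_eq_square)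
  also have "\<dots> = (strain (p + h))\<^sup>2 - (strain p)\<^sup>2 - 2 * (stress p * h)"
    unfolding strain_def stress_def by (simp add: power2_eq_square field_simps)
  finally show ?thesis by simp
qed

lemma stress_slope_pos:
  fixes a b :: real
  assumes "\<bar>a\<bar> \<le> 1/4" and "\<bar>b\<bar> \<le> 1/4"
  shows "1 + 3/2 * (a + b) + 1/2 * (a\<^sup>2 + a * b + b\<^sup>2) > 0"
proof -
  have "a\<^sup>2 + a * b + b\<^sup>2 = (a + b/2)\<^sup>2 + 3/4 * b\<^sup>2"
    by (simp add: power2_eq_square field_simps)
  then have "0 \<le> 1/2 * (a\<^sup>2 + a * b + b\<^sup>2)" by simp
  moreover have "0 < 1 + 3/2 * (a + b)" using assms unfolding distrib_left by linarith
  ultimately show ?thesis by (rule add_pos_nonneg[rotated])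
qed

lemma stress_diff:
  "stress b - stress a = (b - a) * (1 + 3/2 * (a + b) + 1/2 * (a\<^sup>2 + a * b + b\<^sup>2))"
  unfolding stress_def strain_def by (simp add: power2_eq_square field_simps)

text \<open>
  Young's inequality. Its right-hand side is the conjugate of the quadratic \<open>c / 2 * s\<^sup>2\<close>; applied
  pointwise it bounds both dual functionals from above.
\<close>

lemma square_conjugate_bound:
  fixes c s y :: real
  assumes "c > 0" shows "s * y - c / 2 * s\<^sup>2 \<le> y\<^sup>2 / (2 * c)"
proof -
  have "y\<^sup>2 / (2 * c) - (s * y - c / 2 * s\<^sup>2) = (y - c * s)\<^sup>2 / (2 * c)"
    using assms by (simp add: power2_eq_square field_simps)
  also have "\<dots> \<ge> 0" using assms by simp
  finally show ?thesis by simp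
qed

text \<open>
  In the variables \<open>s = a + b\<^sup>2 / 2\<close> and \<open>b\<close> the integrand of \<open>G_star\<close> decouples into two concave
  quadratics: shifting \<open>a\<close> costs \<open>y * b\<^sup>2 / 2\<close>, which changes the coefficient of \<open>b\<^sup>2\<close> from \<open>K / 2\<close>
  to \<open>(y + K) / 2\<close>. This is where positivity of \<open>z + v2 + K\<close> is needed.
\<close>

lemma membrane_conjugate_bound:
  fixes K y w a b :: real
  assumes "K > 0" and "y + K > 0"
  shows "a * y + b * w - K * (a + 1/2 * b\<^sup>2)\<^sup>2 - K / 2 * b\<^sup>2
    \<le> y\<^sup>2 / (4 * K) + w\<^sup>2 / (2 * (y + K))"
proof -
  define s where "s = a + 1/2 * b\<^sup>2"
  have "s * y - K * s\<^sup>2 \<le> y\<^sup>2 / (4 * K)"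
    using square_conjugate_bound[of "2 * K" s y] assms by simp
  moreover have "b * w - (y + K) / 2 * b\<^sup>2 \<le> w\<^sup>2 / (2 * (y + K))"
    using square_conjugate_bound[of "y + K" b w] assms by simp
  moreover have "a * y + b * w - K * (a + 1/2 * b\<^sup>2)\<^sup>2 - K / 2 * b\<^sup>2
      = (s * y - K * s\<^sup>2) + (b * w - (y + K) / 2 * b\<^sup>2)"
    by (simp add: s_def power2_eq_square field_simps)
  ultimately show ?thesis by linarith
qed

text \<open>
  The dual integrand with \<open>K\<close> scaled to 1 and \<open>z = p + h\<close>. Its linear part in \<open>h\<close> vanishes, and what
  remains is \<open>h\<^sup>2\<close> times \<open>1/4 - p\<^sup>2 / (2 * d)\<close> with \<open>d = (1 + p)\<^sup>2 + h\<close>; since \<open>d\<close> is at least 5/16 and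
  \<open>p\<^sup>2\<close> at most 1/16, this factor is positive.
\<close>

lemma dual_integrand_lower_aux:
  fixes p h :: real
  assumes "\<bar>p\<bar> \<le> 1/4" and "\<bar>h\<bar> \<le> 1/4"
  shows "(1 + p)\<^sup>2 + h > 0"
    and "(strain p)\<^sup>2 - 2 * (stress p * p)
     \<le> (p + h)\<^sup>2 / 2 - (h + 2 * p + p\<^sup>2)\<^sup>2 / 4 - ((1 + p)\<^sup>2 * p)\<^sup>2 / (2 * ((1 + p)\<^sup>2 + h))"
proof -
  define d where "d = (1 + p)\<^sup>2 + h"
  have "(3/4)\<^sup>2 \<le> (1 + p)\<^sup>2" using assms by (intro power_mono) auto
  then have d: "d \<ge> 5/16" using assms by (simp add: d_def power2_eq_square)
  then show "(1 + p)\<^sup>2 + h > 0" by (simp add: d_def)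
  have "\<bar>p\<bar>\<^sup>2 \<le> (1/4)\<^sup>2" using assms by (intro power_mono) auto
  then have p2: "2 * p\<^sup>2 \<le> d" using d by (simp add: power2_eq_square)
  \<comment> \<open>Division with remainder in \<open>h\<close>, exact rather than a Taylor estimate.\<close>
  have e: "((1 + p)\<^sup>2)\<^sup>2 / d = (1 + p)\<^sup>2 - h + h\<^sup>2 / d"
    using d by (simp add: d_def power2_eq_square field_simps)
  have "((1 + p)\<^sup>2 * p)\<^sup>2 / (2 * d) = p\<^sup>2 / 2 * (((1 + p)\<^sup>2)\<^sup>2 / d)"
    by (simp add: power_mult_distrib)
  also have "\<dots> = p\<^sup>2 / 2 * ((1 + p)\<^sup>2 - h) + h\<^sup>2 * (p\<^sup>2 / (2 * d))"
    unfolding e by (simp add: field_simps)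
  also have "\<dots> \<le> p\<^sup>2 / 2 * ((1 + p)\<^sup>2 - h) + h\<^sup>2 * (1/4)"
    using d p2 by (intro add_left_mono mult_left_mono) (auto simp: field_simps)
  also have "\<dots> = (p + h)\<^sup>2 / 2 - (h + 2 * p + p\<^sup>2)\<^sup>2 / 4
      - ((strain p)\<^sup>2 - 2 * (stress p * p))"
    unfolding strain_def stress_def by (simp add: power2_eq_square field_simps)
  finally show "(strain p)\<^sup>2 - 2 * (stress p * p)
     \<le> (p + h)\<^sup>2 / 2 - (h + 2 * p + p\<^sup>2)\<^sup>2 / 4 - ((1 + p)\<^sup>2 * p)\<^sup>2 / (2 * ((1 + p)\<^sup>2 + h))"
    by (simp add: d_def)
qed

text \<open>
  The integrand of \<open>J_star\<close> at the candidate \<open>v*\<close> is smallest at \<open>z = K * p\<close>. The left-hand side of the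
  inequality is the density of \<open>J(u)\<close> once the load has been expressed through the stress.
\<close>

lemma dual_integrand_lower:
  fixes K p z :: real
  assumes "K > 0" and "\<bar>p\<bar> \<le> 1/4" and "\<bar>z - K * p\<bar> \<le> K / 4"
  defines "y \<equiv> z + K * (p + p\<^sup>2)"
  shows "y + K > 0"
    and "K * ((strain p)\<^sup>2 - 2 * (stress p * p))
      \<le> z\<^sup>2 / (2 * K) - y\<^sup>2 / (4 * K) - (K * (1 + p)\<^sup>2 * p)\<^sup>2 / (2 * (y + K))"
proof -
  define h where "h = z / K - p"
  have z: "z = K * (p + h)" using assms(1) by (simp add: h_def field_simps)
  have "K * \<bar>h\<bar> \<le> K * (1/4)" using assms(1,3) by (simp add: z algebra_simps abs_mult)
  then have h: "\<bar>h\<bar> \<le> 1/4" using assms(1) by (subst (asm) mult_le_cancel_left_pos) auto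
  define d where "d = (1 + p)\<^sup>2 + h"
  have y: "y = K * (h + 2 * p + p\<^sup>2)" and yK: "y + K = K * d"
    by (simp_all add: y_def z d_def power2_eq_square algebra_simps)
  note * = dual_integrand_lower_aux[OF assms(2) h, folded d_def]
  show "y + K > 0" using *(1) assms(1) by (simp add: yK)
  have "K * ((strain p)\<^sup>2 - 2 * (stress p * p))
      \<le> K * ((p + h)\<^sup>2 / 2 - (h + 2 * p + p\<^sup>2)\<^sup>2 / 4 - ((1 + p)\<^sup>2 * p)\<^sup>2 / (2 * d))"
    using *(2) assms(1) by (intro mult_left_mono) auto
  also have "\<dots> = z\<^sup>2 / (2 * K) - y\<^sup>2 / (4 * K) - (K * (1 + p)\<^sup>2 * p)\<^sup>2 / (2 * (y + K))"
    unfolding yK unfolding z y using assms(1) *(1)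
    by (simp add: power_mult_distrib right_diff_distrib power2_eq_square ac_simps)
  finally show "K * ((strain p)\<^sup>2 - 2 * (stress p * p))
      \<le> z\<^sup>2 / (2 * K) - y\<^sup>2 / (4 * K) - (K * (1 + p)\<^sup>2 * p)\<^sup>2 / (2 * (y + K))" .
qed

section \<open>Function spaces on the interval\<close>

lemma has_derivative_Dx:
  assumes "u differentiable_on {0..L}" and "x \<in> {0..L}"
  shows "(u has_real_derivative Dx L u x) (at x within {0..L})"
  using assms unfolding differentiable_on_def Dx_def has_real_derivative_iff_has_vector_derivative
  by (simp add: vector_derivative_works[symmetric])

lemma Dx_eqI:
  assumes "L > 0" and "x \<in> {0..L}" and "(u has_real_derivative D) (at x within {0..L})"
  shows "Dx L u x = D"
  using assms unfolding Dx_def has_real_derivative_iff_has_vector_derivative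
  by (intro vector_derivative_within_cbox[where a = 0 and b = L, simplified]) auto

lemma U_spaceI:
  assumes "L > 0" and "\<And>x. x \<in> {0..L} \<Longrightarrow> (u has_real_derivative u' x) (at x within {0..L})"
    and "continuous_on {0..L} u'" and "u 0 = 0" and "u L = 0"
  shows "u \<in> U_space L"
proof -
  have "u differentiable_on {0..L}"
    using assms(2) unfolding differentiable_on_def
    by (meson has_field_derivative_imp_has_derivative differentiableI)
  moreover have "continuous_on {0..L} (Dx L u)"
    using assms(3) by (rule continuous_on_eq) (rule Dx_eqI[OF assms(1) _ assms(2), symmetric])
  ultimately show ?thesis using assms by (simp add: U_space_def)
qed

lemma U_spaceD:
  assumes "u \<in> U_space L"
  shows "x \<in> {0..L} \<Longrightarrow> (u has_real_derivative Dx L u x) (at x within {0..L})"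
    and "continuous_on {0..L} u" and "continuous_on {0..L} (Dx L u)" and "u 0 = 0" and "u L = 0"
  using assms has_derivative_Dx by (auto simp: U_space_def differentiable_imp_continuous_on)

lemma U_space_add_scaled:
  assumes "L > 0" and "u \<in> U_space L" and "\<phi> \<in> U_space L"
  shows "(\<lambda>x. u x + \<epsilon> * \<phi> x) \<in> U_space L"
    and "x \<in> {0..L} \<Longrightarrow> Dx L (\<lambda>x. u x + \<epsilon> * \<phi> x) x = Dx L u x + \<epsilon> * Dx L \<phi> x"
proof -
  have D: "((\<lambda>x. u x + \<epsilon> * \<phi> x) has_real_derivative (Dx L u x + \<epsilon> * Dx L \<phi> x)) (at x within {0..L})"
    if "x \<in> {0..L}" for x
    using that by (auto intro!: derivative_eq_intros U_spaceD(1) assms)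
  show "(\<lambda>x. u x + \<epsilon> * \<phi> x) \<in> U_space L"
    by (rule U_spaceI[OF assms(1) D])
      (use U_spaceD[OF assms(2)] U_spaceD[OF assms(3)] in \<open>auto intro!: continuous_intros\<close>)
  show "x \<in> {0..L} \<Longrightarrow> Dx L (\<lambda>x. u x + \<epsilon> * \<phi> x) x = Dx L u x + \<epsilon> * Dx L \<phi> x"
    using Dx_eqI[OF assms(1) _ D] by simp
qed

lemma U_space_diff:
  assumes "L > 0" and "u \<in> U_space L" and "\<phi> \<in> U_space L"
  shows "(\<lambda>x. u x - \<phi> x) \<in> U_space L"
    and "x \<in> {0..L} \<Longrightarrow> Dx L (\<lambda>x. u x - \<phi> x) x = Dx L u x - Dx L \<phi> x"
  using U_space_add_scaled(1)[OF assms, of "-1"] U_space_add_scaled(2)[OF assms, of x "-1"] by simp_all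

lemma abs_le_V_norm:
  assumes "continuous_on {0..L} v" and "x \<in> {0..L}"
  shows "\<bar>v x\<bar> \<le> V_norm L v"
proof -
  have "compact ((\<lambda>x. \<bar>v x\<bar>) ` {0..L})"
    by (intro compact_continuous_image continuous_intros assms) auto
  then show ?thesis unfolding V_norm_def
    by (intro cSUP_upper assms(2)) (auto dest: compact_imp_bounded bounded_imp_bdd_above)
qed

lemma V_norm_zero [simp]: "L > 0 \<Longrightarrow> V_norm L (\<lambda>x. 0) = 0"
  by (simp add: V_norm_def)

lemma abs_Dx_diff_le_U_norm:
  assumes "L > 0" and "u \<in> U_space L" and "w \<in> U_space L" and "x \<in> {0..L}"
  shows "\<bar>Dx L w x - Dx L u x\<bar> \<le> U_norm L (\<lambda>x. w x - u x)"
proof -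
  define d where "d = (\<lambda>x. w x - u x)"
  have d: "d \<in> U_space L" and Dd: "Dx L d x = Dx L w x - Dx L u x"
    unfolding d_def using U_space_diff[OF assms(1,3,2)] assms(4) by blast+
  have "compact ((\<lambda>x. \<bar>d x\<bar> + \<bar>Dx L d x\<bar>) ` {0..L})"
    using U_spaceD[OF d] by (intro compact_continuous_image continuous_intros) auto
  then have "\<bar>d x\<bar> + \<bar>Dx L d x\<bar> \<le> U_norm L d" unfolding U_norm_def
    by (intro cSUP_upper assms(4)) (auto dest: compact_imp_bounded bounded_imp_bdd_above)
  then show ?thesis unfolding Dd by (simp add: d_def)
qed

lemma U_norm_zero: "L > 0 \<Longrightarrow> U_norm L (\<lambda>x. 0) = 0"
  unfolding U_norm_def by (simp add: Dx_eqI[where D = 0])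

text \<open>
  On the interval such a function has two descriptions: it is \<open>C\<^sup>1\<close> on the open interval, and zero off its
  support \<open>S\<close>. Both domains are open relative to the closed interval and together they cover it, so the
  derivative is continuous up to the end points.
\<close>

lemma C1c_subset_U:
  assumes "L > 0" and "\<phi> \<in> C1c_space L"
  shows "\<phi> \<in> U_space L"
proof -
  define S where "S = closure {x \<in> {0..L}. \<phi> x \<noteq> 0}"
  have S: "closed S" "S \<subseteq> {0<..<L}" and zero: "\<And>x. x \<in> {0..L} \<Longrightarrow> x \<notin> S \<Longrightarrow> \<phi> x = 0"
    using assms(2) closure_subset[of "{x \<in> {0..L}. \<phi> x \<noteq> 0}"] by (auto simp: C1c_space_def S_def)
  obtain D where D: "\<And>x. x \<in> {0<..<L} \<Longrightarrow> (\<phi> has_real_derivative D x) (at x)"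
    and contD: "continuous_on {0<..<L} D"
    using assms(2) unfolding C1c_space_def C1_differentiable_on_def
      has_real_derivative_iff_has_vector_derivative by blast
  have D0: "(\<phi> has_real_derivative 0) (at x within {0..L})" if x: "x \<in> {0..L} - S" for x
  proof -
    obtain d where d: "d > 0" "ball x d \<subseteq> - S"
      using x S(1) open_contains_ball[of "- S"] by (metis Compl_iff DiffD2 open_Compl)
    have "((\<lambda>_. 0) has_real_derivative 0) (at x within {0..L})" by simp
    then show ?thesis
      by (rule has_field_derivative_transform_within[OF _ d(1)])
        (use x d(2) zero in \<open>auto simp: dist_commute subset_iff\<close>)
  qed
  define D' where "D' = (\<lambda>x. if x \<in> {0<..<L} then D x else 0)"
  have der: "(\<phi> has_real_derivative D' x) (at x within {0..L})" if "x \<in> {0..L}" for x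
    using that D[of x] D0[of x] subsetD[OF S(2), of x]
    by (auto simp: D'_def intro: has_field_derivative_at_within)
  have D'0: "D' x = 0" if "x \<in> {0..L} - S" for x
    using der[of x] D0[OF that] that Dx_eqI[OF assms(1)] by (metis Diff_iff)
  have U: "{0..L} = {0<..<L} \<union> ({0..L} - S)" using S(2) by auto
  have "continuous_on ({0<..<L} \<union> ({0..L} - S)) D'"
  proof (rule continuous_on_Un_local_open)
    show "openin (top_of_set ({0<..<L} \<union> ({0..L} - S))) {0<..<L}"
      by (rule open_subset) auto
    show "openin (top_of_set ({0<..<L} \<union> ({0..L} - S))) ({0..L} - S)"
      unfolding U[symmetric] openin_open using S(1) by (intro exI[of _ "- S"]) auto
    show "continuous_on {0<..<L} D'"
      using contD by (rule continuous_on_eq) (simp add: D'_def)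
    show "continuous_on ({0..L} - S) D'"
      by (rule continuous_on_eq[of _ "\<lambda>_. 0"]) (use D'0 in auto)
  qed
  then have "continuous_on {0..L} D'" unfolding U[symmetric] .
  moreover have "\<phi> 0 = 0" "\<phi> L = 0" using zero[of 0] zero[of L] subsetD[OF S(2), of 0] subsetD[OF S(2), of L] assms(1)
    by auto
  ultimately show ?thesis using U_spaceI[OF assms(1) der] by blast
qed

lemma integral_by_parts_U:
  assumes "L > 0" and "\<phi> \<in> U_space L" and "continuous_on {0..L} w'"
    and w: "\<And>x. x \<in> {0..L} \<Longrightarrow> (w has_real_derivative w' x) (at x within {0..L})"
  shows "integral {0..L} (\<lambda>x. w x * Dx L \<phi> x) = - integral {0..L} (\<lambda>x. w' x * \<phi> x)"
proof -
  have contw: "continuous_on {0..L} w"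
    using w by (meson DERIV_continuous continuous_on_eq_continuous_within)
  have "((\<lambda>x. w x * Dx L \<phi> x + w' x * \<phi> x) has_integral w L * \<phi> L - w 0 * \<phi> 0) {0..L}"
    using assms(1) by (intro fundamental_theorem_of_calculus)
      (auto simp: has_real_derivative_iff_has_vector_derivative[symmetric]
        intro!: derivative_eq_intros w U_spaceD(1)[OF assms(2)])
  then have "integral {0..L} (\<lambda>x. w x * Dx L \<phi> x + w' x * \<phi> x) = 0"
    using U_spaceD[OF assms(2)] by (simp add: integral_unique)
  moreover have "integral {0..L} (\<lambda>x. w x * Dx L \<phi> x + w' x * \<phi> x)
      = integral {0..L} (\<lambda>x. w x * Dx L \<phi> x) + integral {0..L} (\<lambda>x. w' x * \<phi> x)"
    by (intro integral_add integrable_continuous_real continuous_intros contw assms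
        U_spaceD[OF assms(2)])
  ultimately show ?thesis by simp
qed

section \<open>Variations of the energy\<close>

lemma J_primal_expansion:
  assumes "L > 0" and "continuous_on {0..L} P" and "u \<in> U_space L" and "\<phi> \<in> U_space L"
  shows "J_primal L E A P (\<lambda>x. u x + \<epsilon> * \<phi> x) = J_primal L E A P u
    + \<epsilon> * (E * A * integral {0..L} (\<lambda>x. stress (Dx L u x) * Dx L \<phi> x)
           - integral {0..L} (\<lambda>x. P x * \<phi> x))
    + \<epsilon>^2 * (E * A / 2 * integral {0..L} (\<lambda>x. (strain (Dx L u x) + (1 + Dx L u x)\<^sup>2) * (Dx L \<phi> x)\<^sup>2))
    + \<epsilon>^3 * (E * A / 2 * integral {0..L} (\<lambda>x. (1 + Dx L u x) * Dx L \<phi> x ^ 3))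
    + \<epsilon>^4 * (E * A / 2 * integral {0..L} (\<lambda>x. Dx L \<phi> x ^ 4 / 4))"
proof -
  note U = U_spaceD[OF assms(3)] U_spaceD[OF assms(4)]
  define p where "p = Dx L u"
  define q where "q = Dx L \<phi>"
  have cont: "continuous_on {0..L} p" "continuous_on {0..L} q"
    using U by (simp_all add: p_def q_def)
  have "integral {0..L} (\<lambda>x. (strain (Dx L (\<lambda>x. u x + \<epsilon> * \<phi> x) x))\<^sup>2)
    = integral {0..L} (\<lambda>x. (strain (p x))\<^sup>2 + \<epsilon> * (2 * (stress (p x) * q x))
     + \<epsilon>^2 * ((strain (p x) + (1 + p x)\<^sup>2) * (q x)\<^sup>2) + \<epsilon>^3 * ((1 + p x) * q x^3) + \<epsilon>^4 * (q x^4 / 4))"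
    unfolding p_def q_def using U_space_add_scaled(2)[OF assms(1,3,4)]
    by (intro integral_cong) (simp only: strain_sq_expansion)
  also have "\<dots> = integral {0..L} (\<lambda>x. (strain (p x))\<^sup>2)
     + \<epsilon> * (2 * integral {0..L} (\<lambda>x. stress (p x) * q x))
     + \<epsilon>^2 * integral {0..L} (\<lambda>x. (strain (p x) + (1 + p x)\<^sup>2) * (q x)\<^sup>2)
     + \<epsilon>^3 * integral {0..L} (\<lambda>x. (1 + p x) * q x^3) + \<epsilon>^4 * integral {0..L} (\<lambda>x. q x^4 / 4)"
    by (intro integral_unique has_integral_add has_integral_mult_right integrable_integral
        integrable_continuous_real continuous_intros cont) auto
  finally have S: "integral {0..L} (\<lambda>x. (strain (Dx L (\<lambda>x. u x + \<epsilon> * \<phi> x) x))\<^sup>2) = \<dots>" .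
  have W: "integral {0..L} (\<lambda>x. P x * (u x + \<epsilon> * \<phi> x))
    = integral {0..L} (\<lambda>x. P x * u x) + \<epsilon> * integral {0..L} (\<lambda>x. P x * \<phi> x)"
  proof -
    have "integral {0..L} (\<lambda>x. P x * (u x + \<epsilon> * \<phi> x))
      = integral {0..L} (\<lambda>x. P x * u x + \<epsilon> * (P x * \<phi> x))"
      by (simp add: algebra_simps)
    also have "\<dots> = integral {0..L} (\<lambda>x. P x * u x) + \<epsilon> * integral {0..L} (\<lambda>x. P x * \<phi> x)"
      by (intro integral_unique has_integral_add has_integral_mult_right integrable_integral
          integrable_continuous_real continuous_intros assms U)
    finally show ?thesis .
  qed
  show ?thesis
    unfolding J_primal_def strain_def[symmetric] S W p_def[symmetric] q_def[symmetric]
    by (simp add: field_simps)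
qed

lemma first_variation_zero_imp_weak_equation:
  assumes "L > 0" and "continuous_on {0..L} P" and "u \<in> U_space L" and "\<phi> \<in> U_space L"
    and "first_variation_zero (J_primal L E A P) (U_space L) u"
  shows "E * A * integral {0..L} (\<lambda>x. stress (Dx L u x) * Dx L \<phi> x) = integral {0..L} (\<lambda>x. P x * \<phi> x)"
proof -
  have "((\<lambda>\<epsilon>. J_primal L E A P (\<lambda>x. u x + \<epsilon> * \<phi> x)) has_real_derivative
     (E * A * integral {0..L} (\<lambda>x. stress (Dx L u x) * Dx L \<phi> x) - integral {0..L} (\<lambda>x. P x * \<phi> x))) (at 0)"
    unfolding J_primal_expansion[OF assms(1-4)] by (auto intro!: derivative_eq_intros)
  moreover have "((\<lambda>\<epsilon>. J_primal L E A P (\<lambda>x. u x + \<epsilon> * \<phi> x)) has_real_derivative 0) (at 0)"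
    using assms(4,5) by (simp add: first_variation_zero_def)
  ultimately show ?thesis using DERIV_unique by fastforce
qed

lemma second_variation_J_primal:
  assumes "L > 0" and "continuous_on {0..L} P" and "u \<in> U_space L" and "\<phi> \<in> U_space L"
  shows "second_variation (J_primal L E A P) u \<phi> =
    E * A * integral {0..L} (\<lambda>x. (strain (Dx L u x) + (1 + Dx L u x)\<^sup>2) * (Dx L \<phi> x)\<^sup>2)"
proof -
  have "deriv (deriv (\<lambda>e. c0 + e * c1 + e^2 * c2 + e^3 * c3 + e^4 * c4)) 0 = 2 * c2"
    for c0 c1 c2 c3 c4 :: real
  proof -
    have "deriv (\<lambda>e. c0 + e * c1 + e^2 * c2 + e^3 * c3 + e^4 * c4)
      = (\<lambda>e. c1 + 2 * e * c2 + 3 * e^2 * c3 + 4 * e^3 * c4)"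
      by (rule ext, rule DERIV_imp_deriv) (auto intro!: derivative_eq_intros)
    then show ?thesis by (auto intro!: DERIV_imp_deriv derivative_eq_intros)
  qed
  then show ?thesis
    unfolding second_variation_def J_primal_expansion[OF assms] by (simp only:) simp
qed

text \<open>
  With \<open>R\<close> a primitive of \<open>P\<close>, integration by parts makes \<open>s + R\<close> orthogonal to all derivatives of
  functions in \<open>U_space\<close>. The deviation \<open>g\<close> of \<open>s + R\<close> from its mean \<open>c\<close> is itself such a derivative,
  because its integral vanishes. Hence \<open>g\<close> is orthogonal to itself and \<open>s = c - R\<close>.
\<close>

lemma du_Bois_Reymond:
  assumes "L > 0" and "continuous_on {0..L} s" and "continuous_on {0..L} P"
    and weak: "\<And>\<phi>. \<phi> \<in> U_space L \<Longrightarrow>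
      integral {0..L} (\<lambda>x. s x * Dx L \<phi> x) = integral {0..L} (\<lambda>x. P x * \<phi> x)"
    and x: "x \<in> {0..L}"
  shows "(s has_real_derivative - P x) (at x within {0..L})"
proof -
  define R where "R = (\<lambda>y. integral {0..y} P)"
  have R: "(R has_real_derivative P y) (at y within {0..L})" if "y \<in> {0..L}" for y
    unfolding R_def by (rule integral_has_real_derivative[OF assms(3) that])
  then have contR: "continuous_on {0..L} R"
    by (meson DERIV_continuous continuous_on_eq_continuous_within)
  define c where "c = integral {0..L} (\<lambda>y. s y + R y) / L"
  define g where "g = (\<lambda>y. s y + R y - c)"
  have contg: "continuous_on {0..L} g" unfolding g_def by (intro continuous_intros assms contR)
  have "integral {0..L} g = integral {0..L} (\<lambda>y. s y + R y) - integral {0..L} (\<lambda>y. c)"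
    unfolding g_def
    by (intro integral_diff integrable_continuous_real continuous_intros assms contR)
  then have g0: "integral {0..L} g = 0" using assms(1) by (simp add: c_def)
  define \<phi> where "\<phi> = (\<lambda>y. integral {0..y} g)"
  have der: "(\<phi> has_real_derivative g y) (at y within {0..L})" if "y \<in> {0..L}" for y
    unfolding \<phi>_def by (rule integral_has_real_derivative[OF contg that])
  have \<phi>: "\<phi> \<in> U_space L"
    by (rule U_spaceI[OF assms(1) der contg]) (auto simp: \<phi>_def g0)
  have D\<phi>: "Dx L \<phi> y = g y" if "y \<in> {0..L}" for y
    using Dx_eqI[OF assms(1) that der[OF that]] .
  have "integral {0..L} (\<lambda>y. g y * g y) = integral {0..L} (\<lambda>y. s y * g y + R y * g y - c * g y)"
    unfolding g_def by (simp add: algebra_simps)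
  also have "\<dots> = integral {0..L} (\<lambda>y. s y * g y) + integral {0..L} (\<lambda>y. R y * g y)
      - c * integral {0..L} g"
    by (intro integral_unique has_integral_add has_integral_diff has_integral_mult_right
        integrable_integral integrable_continuous_real continuous_intros assms contR contg)
  also have "integral {0..L} (\<lambda>y. s y * g y) = integral {0..L} (\<lambda>y. s y * Dx L \<phi> y)"
    by (intro integral_cong) (simp add: D\<phi>)
  also have "\<dots> = integral {0..L} (\<lambda>y. P y * \<phi> y)" using weak[OF \<phi>] .
  also have "integral {0..L} (\<lambda>y. R y * g y) = integral {0..L} (\<lambda>y. R y * Dx L \<phi> y)"
    by (intro integral_cong) (simp add: D\<phi>)
  also have "\<dots> = - integral {0..L} (\<lambda>y. P y * \<phi> y)"
    by (rule integral_by_parts_U[OF assms(1) \<phi> assms(3) R])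
  finally have "integral {0..L} (\<lambda>y. g y * g y) = 0" by (simp add: g0)
  then have "((\<lambda>y. g y * g y) has_integral 0) (cbox 0 L)"
    using integrable_integral[OF integrable_continuous_real, of 0 L "\<lambda>y. g y * g y"] contg
    by (auto intro: continuous_intros)
  then have "\<And>y. y \<in> cbox 0 L \<Longrightarrow> g y * g y = 0"
    by (rule has_integral_0_cbox_imp_0[rotated 2])
      (use assms(1) contg in \<open>auto intro!: continuous_intros\<close>)
  then have s: "s y = c - R y" if "y \<in> {0..L}" for y using that by (force simp: g_def)
  have "((\<lambda>y. c - R y) has_real_derivative - P x) (at x within {0..L})"
    using R[OF x] by (auto intro!: derivative_eq_intros)
  then show ?thesis
    by (rule has_field_derivative_transform_within[OF _ zero_less_one x]) (simp add: s)
qed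

text \<open>
  The difference quotient of the stress is that of \<open>p\<close> times the divided difference \<open>M\<close> of a cubic
  (\<open>stress_diff\<close>). Continuity of \<open>p\<close> makes \<open>M\<close> converge, and its limit is positive, so the
  quotient of \<open>p\<close> converges. This one-sided argument covers the end points as well, where the usual
  inverse function theorem does not apply directly.
\<close>

lemma differentiable_of_stress:
  assumes "continuous_on S p" and small: "\<And>y. y \<in> S \<Longrightarrow> \<bar>p y\<bar> \<le> 1/4" and x: "x \<in> S"
    and D: "((\<lambda>y. stress (p y)) has_real_derivative D) (at x within S)"
  shows "p differentiable (at x within S)"
proof -
  define M where "M = (\<lambda>y. 1 + 3/2 * (p x + p y) + 1/2 * ((p x)\<^sup>2 + p x * p y + (p y)\<^sup>2))"
  have M: "M y > 0" if "y \<in> S" for y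
    unfolding M_def by (rule stress_slope_pos) (use small that x in auto)
  have lim: "((\<lambda>y. (stress (p y) - stress (p x)) / (y - x)) \<longlongrightarrow> D) (at x within S)"
    using D unfolding has_field_derivative_iff .
  have "(p \<longlongrightarrow> p x) (at x within S)" using assms(1) x by (simp add: continuous_on_def)
  then have "(M \<longlongrightarrow> M x) (at x within S)" unfolding M_def by (intro tendsto_intros)
  then have "((\<lambda>y. (stress (p y) - stress (p x)) / (y - x) / M y) \<longlongrightarrow> D / M x) (at x within S)"
    by (intro tendsto_divide lim) (use M[OF x] in auto)
  then have "((\<lambda>y. (p y - p x) / (y - x)) \<longlongrightarrow> D / M x) (at x within S)"
  proof (rule Lim_transform_eventually)
    show "\<forall>\<^sub>F y in at x within S.
        (stress (p y) - stress (p x)) / (y - x) / M y = (p y - p x) / (y - x)"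
      unfolding eventually_at_filter
    proof (intro always_eventually allI impI)
      fix y assume "y \<in> S"
      have "stress (p y) - stress (p x) = (p y - p x) * M y" unfolding M_def by (rule stress_diff)
      then show "(stress (p y) - stress (p x)) / (y - x) / M y = (p y - p x) / (y - x)"
        using M[OF \<open>y \<in> S\<close>] by simp
    qed
  qed
  then have "(p has_real_derivative D / M x) (at x within S)"
    unfolding has_field_derivative_iff .
  then show ?thesis by (meson has_field_derivative_imp_has_derivative differentiableI)
qed

lemma J_primal_local_minimum:
  assumes "L > 0" and "E * A > 0" and "continuous_on {0..L} P"
    and "u \<in> U_space L" and "w \<in> U_space L"
    and "\<And>x. x \<in> {0..L} \<Longrightarrow> \<bar>Dx L u x\<bar> \<le> 1/4"
    and "\<And>x. x \<in> {0..L} \<Longrightarrow> \<bar>Dx L w x - Dx L u x\<bar> \<le> 1/4"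
    and "first_variation_zero (J_primal L E A P) (U_space L) u"
  shows "J_primal L E A P u \<le> J_primal L E A P w"
proof -
  define \<phi> where "\<phi> = (\<lambda>x. w x - u x)"
  have \<phi>: "\<phi> \<in> U_space L" and D\<phi>: "\<And>x. x \<in> {0..L} \<Longrightarrow> Dx L \<phi> x = Dx L w x - Dx L u x"
    unfolding \<phi>_def using U_space_diff[OF assms(1,5,4)] by blast+
  note U = U_spaceD[OF assms(4)] U_spaceD[OF assms(5)] U_spaceD[OF \<phi>]
  have "integral {0..L} (\<lambda>x. (strain (Dx L u x))\<^sup>2) + 2 * integral {0..L} (\<lambda>x. stress (Dx L u x) * Dx L \<phi> x)
     = integral {0..L} (\<lambda>x. (strain (Dx L u x))\<^sup>2 + 2 * (stress (Dx L u x) * Dx L \<phi> x))"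
    by (intro integral_unique[symmetric] has_integral_add has_integral_mult_right
        integrable_integral integrable_continuous_real continuous_intros U)
  also have "\<dots> \<le> integral {0..L} (\<lambda>x. (strain (Dx L w x))\<^sup>2)"
  proof (intro integral_le integrable_continuous_real continuous_intros U)
    fix x assume x: "x \<in> {0..L}"
    show "(strain (Dx L u x))\<^sup>2 + 2 * (stress (Dx L u x) * Dx L \<phi> x) \<le> (strain (Dx L w x))\<^sup>2"
      using strain_sq_above_tangent[OF assms(6,7)[OF x]] by (simp add: D\<phi>[OF x])
  qed
  finally have "E * A / 2 * (integral {0..L} (\<lambda>x. (strain (Dx L u x))\<^sup>2)
        + 2 * integral {0..L} (\<lambda>x. stress (Dx L u x) * Dx L \<phi> x))
      \<le> E * A / 2 * integral {0..L} (\<lambda>x. (strain (Dx L w x))\<^sup>2)"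
    using assms(2) by (intro mult_left_mono) auto
  moreover have "integral {0..L} (\<lambda>x. P x * \<phi> x)
      = integral {0..L} (\<lambda>x. P x * w x) - integral {0..L} (\<lambda>x. P x * u x)"
    unfolding \<phi>_def right_diff_distrib
    by (intro integral_diff integrable_continuous_real continuous_intros assms U)
  ultimately show ?thesis
    using first_variation_zero_imp_weak_equation[OF assms(1,3,4) \<phi> assms(8)]
    unfolding J_primal_def strain_def[symmetric] by (simp add: field_simps)
qed

section \<open>The dual functionals\<close>

lemma F_star_eq:
  assumes "K > 0" and "z \<in> V_space L"
  shows "F_star L K z = ereal (integral {0..L} (\<lambda>x. (z x)\<^sup>2 / (2 * K)))"
  unfolding F_star_def
proof (rule antisym)
  have z: "continuous_on {0..L} z" using assms by (simp add: V_space_def)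
  have comb: "L2_inner L v z - F_fun L K v = integral {0..L} (\<lambda>x. v x * z x - K / 2 * (v x)\<^sup>2)"
    if v: "continuous_on {0..L} v" for v
    unfolding L2_inner_def F_fun_def
    by (intro integral_unique[symmetric] has_integral_diff has_integral_mult_right
        integrable_integral integrable_continuous_real continuous_intros z v)
  show "(SUP v\<in>V_space L. ereal (L2_inner L v z - F_fun L K v))
    \<le> ereal (integral {0..L} (\<lambda>x. (z x)\<^sup>2 / (2 * K)))"
  proof (rule SUP_least)
    fix v assume "v \<in> V_space L"
    then have v: "continuous_on {0..L} v" by (simp add: V_space_def)
    show "ereal (L2_inner L v z - F_fun L K v) \<le> ereal (integral {0..L} (\<lambda>x. (z x)\<^sup>2 / (2 * K)))"
      unfolding comb[OF v] ereal_less_eq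
      by (intro integral_le integrable_continuous_real continuous_intros z v
          square_conjugate_bound assms(1)) (use assms(1) in auto)
  qed
  define v where "v = (\<lambda>x. z x / K)"
  have v: "continuous_on {0..L} v" unfolding v_def using assms(1) by (intro continuous_intros z) auto
  have "integral {0..L} (\<lambda>x. (z x)\<^sup>2 / (2 * K)) = L2_inner L v z - F_fun L K v"
    unfolding comb[OF v] using assms(1)
    by (intro integral_cong) (simp add: v_def power2_eq_square field_simps)
  then show "ereal (integral {0..L} (\<lambda>x. (z x)\<^sup>2 / (2 * K)))
    \<le> (SUP v\<in>V_space L. ereal (L2_inner L v z - F_fun L K v))"
    using v by (intro SUP_upper2[of v]) (auto simp: V_space_def)
qed

text \<open>
  Collects the four integrals of the dual functional into one, so that it can be estimated pointwise.
\<close>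

lemma G_star_integrand:
  assumes "continuous_on {0..L} w1" and "continuous_on {0..L} w2" and "continuous_on {0..L} z"
    and "continuous_on {0..L} a" and "continuous_on {0..L} b" and "K = E * A / 2"
  shows "L2_inner L a (\<lambda>x. z x + w2 x) + L2_inner L b w1
       - E * A / 2 * integral {0..L} (\<lambda>x. (a x + 1/2 * (b x)\<^sup>2)\<^sup>2)
       - K / 2 * integral {0..L} (\<lambda>x. (b x)\<^sup>2)
    = integral {0..L} (\<lambda>x. a x * (z x + w2 x) + b x * w1 x - K * (a x + 1/2 * (b x)\<^sup>2)\<^sup>2
       - K / 2 * (b x)\<^sup>2)"
  unfolding L2_inner_def assms(6)[symmetric]
  by (intro integral_unique[symmetric] has_integral_diff has_integral_add has_integral_mult_right
      integrable_integral integrable_continuous_real continuous_intros assms)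

text \<open>
  Weak duality: the pair \<open>(u', u')\<close> is a competitor in the supremum defining \<open>G_star\<close>. With
  \<open>z = K * u'\<close> the quadratic terms \<open>F_star z\<close>, \<open>z * u'\<close> and \<open>K / 2 * u'\<^sup>2\<close> cancel, and the constraint on
  \<open>vs\<close> turns the remaining dual term into the work of the load.
\<close>

lemma J_star_le_J_primal:
  assumes "L > 0" and "E * A > 0" and "continuous_on {0..L} P" and "u \<in> U_space L"
    and "K = E * A / 2" and "vs \<in> A_star L P"
  shows "J_star L E A K vs (\<lambda>x. K * Dx L u x) \<le> ereal (J_primal L E A P u)"
proof -
  obtain w1 w2 where vs: "vs = (w1, w2)" by (cases vs)
  have w: "continuous_on {0..L} w1" "continuous_on {0..L} w2"
    "w1 differentiable_on {0..L}" "w2 differentiable_on {0..L}"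
    and eq: "\<And>x. x \<in> {0..L} \<Longrightarrow> Dx L w1 x + Dx L w2 x = - P x"
    using assms(6) by (auto simp: vs A_star_def V_space_def eq_neg_iff_add_eq_0)
  have K: "K > 0" using assms by simp
  define p where "p = Dx L u"
  have p: "continuous_on {0..L} p" using U_spaceD[OF assms(4)] by (simp add: p_def)
  note cont = w p
  have "integral {0..L} (\<lambda>x. (w1 x + w2 x) * Dx L u x) = - integral {0..L} (\<lambda>x. - P x * u x)"
  proof (rule integral_by_parts_U[OF assms(1,4)])
    fix x assume x: "x \<in> {0..L}"
    show "((\<lambda>x. w1 x + w2 x) has_real_derivative - P x) (at x within {0..L})"
      using has_derivative_Dx[OF w(3) x] has_derivative_Dx[OF w(4) x] eq[OF x]
      by (auto intro!: derivative_eq_intros)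
  qed (intro continuous_intros assms)
  then have load: "integral {0..L} (\<lambda>x. (w1 x + w2 x) * p x) = integral {0..L} (\<lambda>x. P x * u x)"
    by (simp only: p_def mult_minus_left integral_neg minus_minus)
  define g where "g = integral {0..L} (\<lambda>x. p x * (K * p x + w2 x) + p x * w1 x
      - K * (p x + 1/2 * (p x)\<^sup>2)\<^sup>2 - K / 2 * (p x)\<^sup>2)"
  have "continuous_on {0..L} (\<lambda>x. K * p x)" by (intro continuous_intros p)
  note g = G_star_integrand[OF w(1,2) this p p assms(5), folded g_def]
  have "ereal g \<le> G_star L E A K vs (\<lambda>x. K * p x)"
    unfolding G_star_def vs
    by (rule SUP_upper2[of "(p, p)"])
      (simp add: V_space_def p, unfold split_conv fst_conv snd_conv g, rule order_refl)
  then have "J_star L E A K vs (\<lambda>x. K * p x)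
      \<le> ereal (integral {0..L} (\<lambda>x. (K * p x)\<^sup>2 / (2 * K))) - ereal g"
    unfolding J_star_def
    by (subst F_star_eq[OF K]) (simp_all only: V_space_def mem_Collect_eq
        continuous_on_mult_left[OF p] ereal_minus_mono[OF order_refl])
  also have "\<dots> = ereal (integral {0..L} (\<lambda>x. (K * p x)\<^sup>2 / (2 * K)) - g)" by simp
  also have "integral {0..L} (\<lambda>x. (K * p x)\<^sup>2 / (2 * K)) - g
      = integral {0..L} (\<lambda>x. K * (strain (p x))\<^sup>2 - (w1 x + w2 x) * p x)"
    unfolding g_def
  proof (subst integral_diff[symmetric])
    show "integral {0..L} (\<lambda>x. (K * p x)\<^sup>2 / (2 * K) - (p x * (K * p x + w2 x) + p x * w1 x
        - K * (p x + 1/2 * (p x)\<^sup>2)\<^sup>2 - K / 2 * (p x)\<^sup>2))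
      = integral {0..L} (\<lambda>x. K * (strain (p x))\<^sup>2 - (w1 x + w2 x) * p x)"
      using K by (intro integral_cong) (simp add: strain_def power2_eq_square field_simps)
  qed (intro integrable_continuous_real continuous_intros cont; use K in simp)+
  also have "\<dots> = K * integral {0..L} (\<lambda>x. (strain (p x))\<^sup>2) - integral {0..L} (\<lambda>x. (w1 x + w2 x) * p x)"
    by (intro integral_unique has_integral_diff has_integral_mult_right
        integrable_integral integrable_continuous_real continuous_intros cont)
  also have "\<dots> = J_primal L E A P u"
    unfolding load unfolding J_primal_def assms(5) strain_def p_def by simp
  finally show ?thesis by (simp add: p_def)
qed

text \<open>
  Bounding \<open>G_star\<close> above by the integral of the pointwise conjugate bounds \<open>J_star\<close> below. The pointwise
  inequality compares this bound with the energy, in which the weak equation, tested with \<open>u\<close>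
  itself, has replaced the load by the stress.
\<close>

lemma J_star_ge_J_primal:
  assumes "L > 0" and "E * A > 0" and "continuous_on {0..L} P" and "u \<in> U_space L"
    and K: "K = E * A / 2" and small: "\<And>x. x \<in> {0..L} \<Longrightarrow> \<bar>Dx L u x\<bar> \<le> 1/4"
    and "first_variation_zero (J_primal L E A P) (U_space L) u"
    and z: "continuous_on {0..L} z"
    and near: "\<And>x. x \<in> {0..L} \<Longrightarrow> \<bar>z x - K * Dx L u x\<bar> \<le> K / 4"
  shows "ereal (J_primal L E A P u) \<le> J_star L E A K
    (\<lambda>x. K * (1 + Dx L u x)\<^sup>2 * Dx L u x, \<lambda>x. K * (Dx L u x + (Dx L u x)\<^sup>2)) z"
proof -
  have K0: "K > 0" using assms by simp
  define p where "p = Dx L u"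
  have p: "continuous_on {0..L} p" using U_spaceD[OF assms(4)] by (simp add: p_def)
  define w1 where "w1 = (\<lambda>x. K * (1 + p x)\<^sup>2 * p x)"
  define w2 where "w2 = (\<lambda>x. K * (p x + (p x)\<^sup>2))"
  have w: "continuous_on {0..L} w1" "continuous_on {0..L} w2"
    unfolding w1_def w2_def by (intro continuous_intros p)+
  note low = dual_integrand_lower[OF K0 small near, folded p_def]
  have pos: "z x + w2 x + K > 0" if "x \<in> {0..L}" for x
    using low(1)[OF that that] by (simp add: w2_def)
  define g where "g = integral {0..L} (\<lambda>x. (z x + w2 x)\<^sup>2 / (4 * K) + (w1 x)\<^sup>2 / (2 * (z x + w2 x + K)))"
  have contg: "continuous_on {0..L} (\<lambda>x. (z x + w2 x)\<^sup>2 / (4 * K) + (w1 x)\<^sup>2 / (2 * (z x + w2 x + K)))"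
    using pos K0 by (intro continuous_intros w z) force+
  have "G_star L E A K (w1, w2) z \<le> ereal g"
    unfolding G_star_def
  proof (rule SUP_least, clarify)
    fix a b assume "a \<in> V_space L" "b \<in> V_space L"
    then have ab: "continuous_on {0..L} a" "continuous_on {0..L} b" by (auto simp: V_space_def)
    show "ereal (L2_inner L a (\<lambda>x. z x + snd (w1, w2) x) + L2_inner L b (fst (w1, w2))
       - E * A / 2 * integral {0..L} (\<lambda>x. (a x + 1/2 * (b x)\<^sup>2)\<^sup>2)
       - K / 2 * integral {0..L} (\<lambda>x. (b x)\<^sup>2)) \<le> ereal g"
      unfolding fst_conv snd_conv G_star_integrand[OF w z ab K] g_def ereal_less_eq
      by (rule integral_le[OF integrable_continuous_real integrable_continuous_real[OF contg]])
        ((intro continuous_intros w z ab)[1], intro membrane_conjugate_bound K0 pos)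
  qed
  then have "ereal (integral {0..L} (\<lambda>x. (z x)\<^sup>2 / (2 * K))) - ereal g \<le> J_star L E A K (w1, w2) z"
    unfolding J_star_def
    by (subst F_star_eq[OF K0])
      (simp_all only: V_space_def mem_Collect_eq z ereal_minus_mono[OF order_refl])
  moreover have "J_primal L E A P u \<le> integral {0..L} (\<lambda>x. (z x)\<^sup>2 / (2 * K)) - g"
  proof -
    have "J_primal L E A P u = K * integral {0..L} (\<lambda>x. (strain (p x))\<^sup>2)
        - K * (2 * integral {0..L} (\<lambda>x. stress (p x) * p x))"
      unfolding J_primal_def p_def strain_def[symmetric]
        first_variation_zero_imp_weak_equation[OF assms(1,3,4,4,7), symmetric]
      by (simp add: K)
    also have "\<dots> = integral {0..L} (\<lambda>x. K * (strain (p x))\<^sup>2 - K * (2 * (stress (p x) * p x)))"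
      by (intro integral_unique[symmetric] has_integral_diff has_integral_mult_right
          integrable_integral integrable_continuous_real continuous_intros p)
    also have "\<dots> \<le> integral {0..L} (\<lambda>x. (z x)\<^sup>2 / (2 * K)
        - ((z x + w2 x)\<^sup>2 / (4 * K) + (w1 x)\<^sup>2 / (2 * (z x + w2 x + K))))"
    proof (rule integral_le)
      fix x assume x: "x \<in> {0..L}"
      show "K * (strain (p x))\<^sup>2 - K * (2 * (stress (p x) * p x)) \<le> (z x)\<^sup>2 / (2 * K)
        - ((z x + w2 x)\<^sup>2 / (4 * K) + (w1 x)\<^sup>2 / (2 * (z x + w2 x + K)))"
        using low(2)[OF x x] by (simp add: w1_def w2_def right_diff_distrib)
    qed (intro integrable_continuous_real continuous_intros p z contg; use K0 in simp)+
    also have "\<dots> = integral {0..L} (\<lambda>x. (z x)\<^sup>2 / (2 * K)) - g"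
      unfolding g_def using K0
      by (intro integral_diff integrable_continuous_real contg) (intro continuous_intros z; simp)
    finally show ?thesis .
  qed
  ultimately have "ereal (J_primal L E A P u) \<le> J_star L E A K (w1, w2) z"
    by (metis ereal_less_eq(3) ereal_minus(1) order_trans)
  then show ?thesis by (simp add: w1_def w2_def p_def)
qed

text \<open>
  The two components add up to \<open>E * A * stress (u')\<close>, because
  \<open>(1 + p)\<^sup>2 * p + p + p\<^sup>2 = 2 * stress p\<close>.
\<close>

lemma equilibrium_in_A_star:
  assumes "L > 0" and "continuous_on {0..L} P" and "u \<in> U_space L"
    and K: "K = E * A / 2" "K > 0" and small: "\<And>x. x \<in> {0..L} \<Longrightarrow> \<bar>Dx L u x\<bar> \<le> 1/4"
    and "first_variation_zero (J_primal L E A P) (U_space L) u"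
  shows "(\<lambda>x. K * (1 + Dx L u x)\<^sup>2 * Dx L u x, \<lambda>x. K * (Dx L u x + (Dx L u x)\<^sup>2)) \<in> A_star L P"
proof -
  define p where "p = Dx L u"
  have p: "continuous_on {0..L} p" using U_spaceD[OF assms(3)] by (simp add: p_def)
  define s where "s = (\<lambda>x. 2 * K * stress (p x))"
  have s: "(s has_real_derivative - P x) (at x within {0..L})" if "x \<in> {0..L}" for x
  proof (rule du_Bois_Reymond[OF assms(1) _ assms(2) _ that])
    show "continuous_on {0..L} s" unfolding s_def by (intro continuous_intros p)
    fix \<phi> assume "\<phi> \<in> U_space L"
    from first_variation_zero_imp_weak_equation[OF assms(1-3) this assms(7)]
    show "integral {0..L} (\<lambda>x. s x * Dx L \<phi> x) = integral {0..L} (\<lambda>x. P x * \<phi> x)"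
      by (simp add: s_def p_def K mult.assoc)
  qed
  have dp: "p differentiable (at x within {0..L})" if x: "x \<in> {0..L}" for x
  proof (rule differentiable_of_stress[OF p _ x])
    show "\<bar>p y\<bar> \<le> 1/4" if "y \<in> {0..L}" for y using small[OF that] by (simp add: p_def)
    have "((\<lambda>y. s y / (2 * K)) has_real_derivative - P x / (2 * K)) (at x within {0..L})"
      using s[OF x] by (rule DERIV_cdivide)
    then show "((\<lambda>y. stress (p y)) has_real_derivative - P x / (2 * K)) (at x within {0..L})"
      using K(2) by (simp add: s_def)
  qed
  define w1 where "w1 = (\<lambda>x. K * (1 + p x)\<^sup>2 * p x)"
  define w2 where "w2 = (\<lambda>x. K * (p x + (p x)\<^sup>2))"
  have dw: "w1 differentiable_on {0..L}" "w2 differentiable_on {0..L}"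
    unfolding w1_def w2_def differentiable_on_def using dp by (auto intro!: derivative_intros)
  have "Dx L w1 x + Dx L w2 x + P x = 0" if x: "x \<in> {0..L}" for x
  proof -
    have "((\<lambda>x. w1 x + w2 x) has_real_derivative Dx L w1 x + Dx L w2 x) (at x within {0..L})"
      by (intro derivative_intros has_derivative_Dx dw x)
    moreover have "(\<lambda>x. w1 x + w2 x) = s"
      by (auto simp: fun_eq_iff w1_def w2_def s_def stress_def strain_def power2_eq_square field_simps)
    ultimately have "Dx L s x = Dx L w1 x + Dx L w2 x" using Dx_eqI[OF assms(1) x] by simp
    then show ?thesis using Dx_eqI[OF assms(1) x s[OF x]] by simp
  qed
  moreover have "w1 \<in> V_space L" "w2 \<in> V_space L"
    unfolding w1_def w2_def V_space_def by (auto intro!: continuous_intros p)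
  ultimately have "(w1, w2) \<in> A_star L P" using dw by (simp add: A_star_def)
  then show ?thesis by (simp add: w1_def w2_def p_def)
qed

theorem theorem2p1:
  fixes L E A K :: real and P u0 z_hat v1_hat v2_hat :: "real \<Rightarrow> real"
  assumes "L > 0" and "E > 0" and "A > 0"
    and "continuous_on {0..L} P"
    and "u0 \<in> U_hat L"
    and "first_variation_zero (J_primal L E A P) (U_space L) u0"
    and "K = E * A / 2"
    and "z_hat = (\<lambda>x. K * Dx L u0 x)"
    and "v2_hat = (\<lambda>x. E * A * (Dx L u0 x + 1/2 * (Dx L u0 x)\<^sup>2) - z_hat x)"
    and "v1_hat = (\<lambda>x. (z_hat x + v2_hat x + K) * Dx L u0 x)"
  shows "(\<forall>\<phi>\<in>C1c_space L. second_variation (J_primal L E A P) u0 \<phi> \<ge> 0) \<and>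
    (\<exists>r>0. \<exists>r1>0. \<exists>r2>0.
       ereal (J_primal L E A P u0) = (INF u\<in>U_ball L u0 r. ereal (J_primal L E A P u)) \<and>
       (INF u\<in>U_ball L u0 r. ereal (J_primal L E A P u)) =
         (SUP vs\<in>VV_ball L (v1_hat, v2_hat) r2 \<inter> A_star L P.
            INF z\<in>V_ball L z_hat r1. J_star L E A K vs z) \<and>
       (SUP vs\<in>VV_ball L (v1_hat, v2_hat) r2 \<inter> A_star L P.
            INF z\<in>V_ball L z_hat r1. J_star L E A K vs z) =
         J_star L E A K (v1_hat, v2_hat) z_hat)"
proof -
  have EA: "E * A > 0" using assms(2,3) by simp
  then have K: "K > 0" using assms(7) by simp
  have u0: "u0 \<in> U_space L" using assms(5) by (simp add: U_hat_def)
  note U0 = U_spaceD[OF u0]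
  have small: "\<bar>Dx L u0 x\<bar> \<le> 1/4" if "x \<in> {0..L}" for x
    using abs_le_V_norm[OF U0(3) that] assms(5) by (simp add: U_hat_def)
  have v2: "v2_hat = (\<lambda>x. K * (Dx L u0 x + (Dx L u0 x)\<^sup>2))"
    by (auto simp: fun_eq_iff assms(7-9) power2_eq_square field_simps)
  have v1: "v1_hat = (\<lambda>x. K * (1 + Dx L u0 x)\<^sup>2 * Dx L u0 x)"
    unfolding assms(10) v2 assms(8) by (auto simp: fun_eq_iff power2_eq_square field_simps)
  have "second_variation (J_primal L E A P) u0 \<phi> \<ge> 0" if "\<phi> \<in> C1c_space L" for \<phi>
  proof -
    note \<phi> = C1c_subset_U[OF assms(1) that]
    have "integral {0..L} (\<lambda>x. (strain (Dx L u0 x) + (1 + Dx L u0 x)\<^sup>2) * (Dx L \<phi> x)\<^sup>2) \<ge> 0"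
      by (intro integral_nonneg integrable_continuous_real continuous_intros U0 U_spaceD[OF \<phi>])
        (auto intro!: mult_nonneg_nonneg stiffness_nonneg small)
    then show ?thesis
      unfolding second_variation_J_primal[OF assms(1,4) u0 \<phi>] using EA by simp
  qed
  moreover have "ereal (J_primal L E A P u0) = (INF u\<in>U_ball L u0 (1/4). ereal (J_primal L E A P u))"
  proof (rule antisym)
    show "ereal (J_primal L E A P u0) \<le> (INF u\<in>U_ball L u0 (1/4). ereal (J_primal L E A P u))"
    proof (rule INF_greatest)
      fix w assume "w \<in> U_ball L u0 (1/4)"
      then have w: "w \<in> U_space L" "U_norm L (\<lambda>x. w x - u0 x) \<le> 1/4" by (auto simp: U_ball_def)
      have "\<bar>Dx L w x - Dx L u0 x\<bar> \<le> 1/4" if "x \<in> {0..L}" for x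
        using abs_Dx_diff_le_U_norm[OF assms(1) u0 w(1) that] w(2) by linarith
      then show "ereal (J_primal L E A P u0) \<le> ereal (J_primal L E A P w)"
        using J_primal_local_minimum[OF assms(1) EA assms(4) u0 w(1) small _ assms(6)] by simp
    qed
    show "(INF u\<in>U_ball L u0 (1/4). ereal (J_primal L E A P u)) \<le> ereal (J_primal L E A P u0)"
      by (rule INF_lower) (simp add: U_ball_def u0 U_norm_zero assms(1))
  qed
  \<comment> \<open>Within \<open>K / 4\<close> of \<open>z_hat\<close> the denominator \<open>z + v2_hat + K\<close> stays above twice
    \<open>K * (Dx L u0)\<^sup>2\<close>; the lower bound rests on this.\<close>
  moreover have lower: "ereal (J_primal L E A P u0) \<le> J_star L E A K (v1_hat, v2_hat) z"
    if "z \<in> V_ball L z_hat (K/4)" for z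
    unfolding v1 v2
  proof (rule J_star_ge_J_primal[OF assms(1) EA assms(4) u0 assms(7) small assms(6)])
    show z: "continuous_on {0..L} z" using that by (simp add: V_ball_def V_space_def)
    fix x assume x: "x \<in> {0..L}"
    have "continuous_on {0..L} (\<lambda>x. z x - z_hat x)"
      unfolding assms(8) by (intro continuous_intros z U0)
    from abs_le_V_norm[OF this x] show "\<bar>z x - K * Dx L u0 x\<bar> \<le> K / 4"
      using that by (simp add: V_ball_def assms(8))
  qed
  have zhat: "z_hat \<in> V_ball L z_hat (K/4)"
    using assms(1) K by (auto simp: V_ball_def V_space_def assms(8) intro!: continuous_intros U0)
  have upper: "J_star L E A K vs z_hat \<le> ereal (J_primal L E A P u0)" if "vs \<in> A_star L P" for vs
    using J_star_le_J_primal[OF assms(1) EA assms(4) u0 assms(7) that] by (simp add: assms(8))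
  \<comment> \<open>Weak duality holds on all of the constraint set, so any positive radius works for \<open>r2\<close>.\<close>
  have vhat: "(v1_hat, v2_hat) \<in> VV_ball L (v1_hat, v2_hat) 1 \<inter> A_star L P"
  proof
    show A: "(v1_hat, v2_hat) \<in> A_star L P" unfolding v1 v2
      by (rule equilibrium_in_A_star[OF assms(1,4) u0 assms(7) K small assms(6)])
    then show "(v1_hat, v2_hat) \<in> VV_ball L (v1_hat, v2_hat) 1"
      using assms(1) by (simp add: VV_ball_def A_star_def)
  qed
  have "(SUP vs\<in>VV_ball L (v1_hat, v2_hat) 1 \<inter> A_star L P.
            INF z\<in>V_ball L z_hat (K/4). J_star L E A K vs z) = ereal (J_primal L E A P u0)"
  proof (rule antisym)
    show "(SUP vs\<in>VV_ball L (v1_hat, v2_hat) 1 \<inter> A_star L P.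
            INF z\<in>V_ball L z_hat (K/4). J_star L E A K vs z) \<le> ereal (J_primal L E A P u0)"
      using upper by (intro SUP_least INF_lower2[OF zhat]) auto
    show "ereal (J_primal L E A P u0) \<le> (SUP vs\<in>VV_ball L (v1_hat, v2_hat) 1 \<inter> A_star L P.
            INF z\<in>V_ball L z_hat (K/4). J_star L E A K vs z)"
      using lower by (intro SUP_upper2[OF vhat] INF_greatest)
  qed
  moreover have "J_star L E A K (v1_hat, v2_hat) z_hat = ereal (J_primal L E A P u0)"
    using lower[OF zhat] upper vhat by (intro antisym) auto
  moreover have "(1/4 :: real) > 0" "K / 4 > 0" "(1 :: real) > 0" using K by simp_all
  ultimately show ?thesis by metis
qed

end
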